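(* If $X$ is a $CT_3$-space, then $w(Y)=d(Y)$ for each subspace $Y$ of $X$. In particular, every separable subspace of a $CT_3$-space is metrizable.
   Context: All topological spaces are assumed to be $T_1$ and non-empty. $w(Y)$ and $d(Y)$ denote the weight (least cardinality of a base) and the density (least cardinality of a dense subset) of $Y$, with no convention forcing these cardinals to be infinite. For a space $X$, $\mathrm{Cld}(X)$ denotes the set of all non-empty closed subsets of $X$, endowed with the Vietoris topology, i.e. the topology having as a subbase all sets $U^-=\{F\in\mathrm{Cld}(X): F\cap U\neq\emptyset\}$ and $U^+=\{F\in\mathrm{Cld}(X): F\subseteq U\}$ with $U$ open in $X$. Let $\mathcal{T}_3(X)=\{(F_1,F_2)\in\mathrm{Cld}(X)^2: F_1\cap F_2=\emptyset,\ F_1 \text{ is a singleton}\}$, with the subspace topology from the product space $\mathrm{Cld}(X)^2$. The space $X$ is called $CT_3$ if there is a continuous map $\phi=(\phi_1,\phi_2):\mathcal{T}_3(X)\to\mathrm{Cld}(X)^2$ such that for every $(F_1,F_2)\in\mathcal{T}_3(X)$: $\phi_1(F_1,F_2)\cup\phi_2(F_1,F_2)=X$ and $F_j\cap\phi_j(F_1,F_2)=\emptyset$ for $j=1,2$. *)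

theory Defs
  imports "HOL-Analysis.Analysis"
begin

unbundle cardinal_syntax

text \<open>
  The least cardinality of a set satisfying \<open>P\<close>, represented as a cardinal in the sense of the
  HOL theory of cardinals and hence meant to be compared up to \<open>=o\<close>. It is finite whenever some
  finite set satisfies \<open>P\<close>, and it is only meaningful if some set satisfies \<open>P\<close>.
\<close>

definition least_card :: "('b set \<Rightarrow> bool) \<Rightarrow> 'b rel"
  where "least_card P = |SOME A. P A \<and> (\<forall>B. P B \<longrightarrow> |A| \<le>o |B| )|"

lemma least_card_exists:
  fixes P :: "'b set \<Rightarrow> bool"
  assumes "P S"
  shows "\<exists>A. P A \<and> (\<forall>B. P B \<longrightarrow> |A| \<le>o |B| )"
proof -
  have "|S| \<in> card_of ` Collect P"
    using assms by auto
  with wf_ordLess obtain r where r: "r \<in> card_of ` Collect P"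
    and min: "\<And>q. (q, r) \<in> ordLess \<Longrightarrow> q \<notin> card_of ` Collect P"
    by (rule wfE_min) blast
  from r obtain A where A: "P A" "r = |A|"
    by auto
  have "|A| \<le>o |B|" if "P B" for B
  proof (rule ccontr)
    assume "\<not> |A| \<le>o |B|"
    then have "|B| <o |A|"
      by (simp add: not_ordLeq_iff_ordLess[OF card_of_Well_order card_of_Well_order])
    with min[of "|B|"] A that show False
      by auto
  qed
  with A show ?thesis
    by blast
qed

lemma least_card_attained:
  assumes "P S"
  obtains A where "P A" "least_card P = |A|" "\<And>B. P B \<Longrightarrow> |A| \<le>o |B|"
  using someI_ex[of "\<lambda>A. P A \<and> (\<forall>B. P B \<longrightarrow> |A| \<le>o |B| )", OF least_card_exists[of P, OF assms]]
  unfolding least_card_def by blast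

definition base_of :: "'a topology \<Rightarrow> 'a set set \<Rightarrow> bool"
  where "base_of X \<B> \<longleftrightarrow> openin X = arbitrary union_of (\<lambda>U. U \<in> \<B>)"

definition dense_in :: "'a topology \<Rightarrow> 'a set \<Rightarrow> bool"
  where "dense_in X D \<longleftrightarrow> D \<subseteq> topspace X \<and> X closure_of D = topspace X"

definition top_weight :: "'a topology \<Rightarrow> 'a set rel"
  where "top_weight X = least_card (base_of X)"

definition top_density :: "'a topology \<Rightarrow> 'a rel"
  where "top_density X = least_card (dense_in X)"

lemma base_of_openin: "base_of X {U. openin X U}"
  unfolding base_of_def by (auto simp: fun_eq_iff union_of_def arbitrary_def intro!: exI[of _ "{_}"])

lemma dense_in_topspace: "dense_in X (topspace X)"
  by (simp add: dense_in_def)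

definition Cld :: "'a topology \<Rightarrow> 'a set set"
  where "Cld X = {F. closedin X F \<and> F \<noteq> {}}"

definition vietoris :: "'a topology \<Rightarrow> 'a set topology"
  where "vietoris X = topology_generated_by
    ({{F \<in> Cld X. F \<inter> U \<noteq> {}} | U. openin X U} \<union> {{F \<in> Cld X. F \<subseteq> U} | U. openin X U})"

lemma topspace_vietoris [simp]: "topspace (vietoris X) = Cld X"
  unfolding vietoris_def topology_generated_by_topspace
  by (auto simp: Cld_def dest: closedin_subset)

definition T3_pairs :: "'a topology \<Rightarrow> ('a set \<times> 'a set) set"
  where "T3_pairs X = {(F1, F2). F1 \<in> Cld X \<and> F2 \<in> Cld X \<and> F1 \<inter> F2 = {} \<and> is_singleton F1}"

text \<open>\<open>T\<^sub>1\<close> and non-emptiness, which are standing assumptions on all spaces, are not included.\<close>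

definition CT3_space :: "'a topology \<Rightarrow> bool"
  where "CT3_space X \<longleftrightarrow>
    (\<exists>\<phi>1 \<phi>2. continuous_map
         (subtopology (prod_topology (vietoris X) (vietoris X)) (T3_pairs X))
         (prod_topology (vietoris X) (vietoris X))
         (\<lambda>p. (\<phi>1 p, \<phi>2 p)) \<and>
       (\<forall>(F1, F2) \<in> T3_pairs X.
         \<phi>1 (F1, F2) \<union> \<phi>2 (F1, F2) = topspace X \<and>
         F1 \<inter> \<phi>1 (F1, F2) = {} \<and> F2 \<inter> \<phi>2 (F1, F2) = {}))"

end

theory Submission
  imports Defs
begin

text \<open>
  Let \<open>\<phi> = (\<phi>1, \<phi>2)\<close> witness that \<open>X\<close> is \<open>CT\<^sub>3\<close>, and let \<open>D\<close> be a dense subset of a subspace \<open>Y\<close>.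
  Given \<open>x \<in> Y\<close> and a non-empty closed set \<open>F\<close> in the closure of \<open>Y\<close> with \<open>x \<notin> F\<close>, the values of \<open>\<phi>\<close> at
  \<open>({x}, F)\<close> satisfy \<open>x \<notin> \<phi>1\<close> and \<open>F \<inter> \<phi>2 = {}\<close>. For fixed \<open>x\<close> and \<open>F\<close> both conditions are open in the
  Vietoris topology, so by continuity they hold for the values of \<open>\<phi>\<close> at all pairs of its domain close
  to \<open>({x}, F)\<close>. Some of these pairs have the form \<open>({d}, S)\<close> with \<open>d \<in> D\<close> and \<open>S \<subseteq> D\<close> finite
  (\<open>finite_separation\<close>). Since \<open>\<phi>1\<close> and \<open>\<phi>2\<close> cover \<open>X\<close>, the open set \<open>X - \<phi>1 ({d}, S)\<close> contains \<open>x\<close>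
  and misses \<open>F\<close>. Hence the sets \<open>Y - \<phi>1 ({d}, S)\<close>, together with \<open>Y\<close>, form a base of \<open>Y\<close>, and if
  \<open>D\<close> is infinite there are no more than \<open>|D|\<close> of them (\<open>dense_imp_base\<close>). If \<open>D\<close> is finite, \<open>Y = D\<close> is
  discrete, with the singletons as a base. So the weight is at most the density; the other
  inequality holds in every space, by choosing a point in each non-empty member of a base.

  For separable \<open>Y\<close> this yields a countable base. Moreover \<open>X\<close> is regular, because \<open>X - \<phi>1 ({x}, F)\<close>
  and \<open>X - \<phi>2 ({x}, F)\<close> are disjoint neighbourhoods of \<open>x\<close> and \<open>F\<close>; metrizability of \<open>Y\<close> then follows
  from Urysohn's theorem, derived here from Urysohn's lemma by an embedding in a countable power of
  the real line.
\<close>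


section \<open>Cardinality of the finite subsets of an infinite set\<close>

lemma card_of_Fpow_ordLeq:
  assumes "infinite A"
  shows "|Fpow A| \<le>o |A|"
proof -
  \<comment> \<open>Sort the finite subsets by their size and bound each of the countably many classes.\<close>
  define F where "F n = {S \<in> Fpow A. card S = n}" for n
  have step: "|F n| \<le>o |A|" for n
  proof (induction n)
    case 0
    have "F 0 = {{}}"
      by (auto simp: F_def Fpow_def)
    then show ?case
      using assms by (simp add: ordLeq3_finite_infinite)
  next
    case (Suc n)
    have "F (Suc n) \<subseteq> (\<lambda>(a, S). insert a S) ` (A \<times> F n)"
    proof
      fix S assume S: "S \<in> F (Suc n)"
      then obtain a T where aT: "S = insert a T" "a \<notin> T" "card T = n"
        by (auto simp: F_def card_Suc_eq)
      with S have "a \<in> A" "T \<in> F n"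
        by (auto simp: F_def Fpow_def)
      with aT show "S \<in> (\<lambda>(a, S). insert a S) ` (A \<times> F n)"
        by force
    qed
    then have "|F (Suc n)| \<le>o |A \<times> F n|"
      by (meson card_of_image card_of_mono1 ordLeq_transitive)
    also have "|A \<times> F n| \<le>o |A|"
      using assms Suc.IH by (intro card_of_Times_ordLeq_infinite_Field)
        (simp_all add: Field_card_of card_of_mono1 card_of_card_order_on)
    finally show ?case .
  qed
  have "Fpow A = (\<Union>n. F n)"
    by (auto simp: F_def)
  moreover have "|\<Union>n. F n| \<le>o |A|"
    by (rule card_of_UNION_ordLeq_infinite[OF assms]) (use step assms infinite_iff_card_of_nat in auto)
  ultimately show ?thesis
    by simp
qed


section \<open>Bases and dense sets\<close>

lemma base_of_iff:
  "base_of X \<B> \<longleftrightarrow> (\<forall>V\<in>\<B>. openin X V) \<and>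
     (\<forall>U x. openin X U \<and> x \<in> U \<longrightarrow> (\<exists>V\<in>\<B>. x \<in> V \<and> V \<subseteq> U))"
  unfolding base_of_def by (auto simp: openin_topology_base_unique Bex_def)

lemma dense_in_subtopology_closure:
  assumes "dense_in (subtopology X Y) D" "Y \<subseteq> topspace X"
  shows "D \<subseteq> Y" "Y \<subseteq> X closure_of D"
  using assms closure_of_subtopology_subset[of X Y D]
  by (auto simp: dense_in_def)

lemma base_imp_dense:
  assumes "base_of X \<B>"
  obtains D where "dense_in X D" "|D| \<le>o |\<B>|"
proof -
  define c where "c V = (SOME x. x \<in> V)" for V :: "'a set"
  have c: "c V \<in> V" if "V \<noteq> {}" for V
    using that unfolding c_def by (simp add: some_in_eq)
  define D where "D = c ` (\<B> - {{}})"
  have open_meets: "\<exists>y\<in>D. y \<in> U" if "openin X U" "x \<in> U" for x U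
  proof -
    obtain V where "V \<in> \<B>" "x \<in> V" "V \<subseteq> U"
      using \<open>base_of X \<B>\<close> \<open>openin X U\<close> \<open>x \<in> U\<close> unfolding base_of_iff by blast
    then show ?thesis
      using c[of V] by (auto simp: D_def)
  qed
  have "V \<subseteq> topspace X" if "V \<in> \<B>" for V
    using \<open>base_of X \<B>\<close> that openin_subset unfolding base_of_iff by blast
  then have "D \<subseteq> topspace X"
    using c by (auto simp: D_def)
  moreover have "topspace X \<subseteq> X closure_of D"
    using open_meets unfolding subset_iff in_closure_of by blast
  ultimately have "dense_in X D"
    by (simp add: dense_in_def closure_of_subset_topspace subset_antisym)
  moreover have "|D| \<le>o |\<B>|"
    unfolding D_def by (meson card_of_image card_of_mono1 Diff_subset ordLeq_transitive)
  ultimately show thesis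
    by (rule that)
qed

text \<open>A finite dense subset of a \<open>T\<^sub>1\<close> space is the whole space, which is then discrete.\<close>

lemma finite_dense_imp_base:
  assumes "t1_space X" "dense_in X D" "finite D"
  shows "\<exists>\<B>. base_of X \<B> \<and> |\<B>| \<le>o |D|"
proof -
  have "closedin X D"
    using assms by (simp add: t1_space_closedin_finite dense_in_def)
  with assms have D: "D = topspace X"
    by (simp add: dense_in_def closure_of_closedin)
  have "openin X {x}" if "x \<in> D" for x
  proof -
    have "closedin X (D - {x})"
      using assms D by (auto simp: t1_space_closedin_finite)
    then have "openin X (topspace X - (D - {x}))"
      by blast
    then show ?thesis
      using that D by (simp add: double_diff)
  qed
  then have "base_of X ((\<lambda>x. {x}) ` D)"
    using D openin_subset unfolding base_of_iff by fastforce
  then show ?thesis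
    using card_of_image by blast
qed


section \<open>Urysohn's metrization theorem\<close>

text \<open>
  If countably many continuous real functions separate the points of a \<open>T\<^sub>1\<close> space from its closed
  sets, then evaluation at these functions embeds the space in a countable power of the reals.
\<close>

lemma separating_family_imp_metrizable:
  fixes f :: "'i \<Rightarrow> 'a \<Rightarrow> real"
  assumes "t1_space X" and "countable I"
    and cont: "\<And>i. i \<in> I \<Longrightarrow> continuous_map X euclideanreal (f i)"
    and sep: "\<And>U x. openin X U \<Longrightarrow> x \<in> U \<Longrightarrow> \<exists>i\<in>I. f i x = 0 \<and> (\<forall>y \<in> topspace X - U. f i y = 1)"
  shows "metrizable_space X"
proof -
  define P where "P = product_topology (\<lambda>_. euclideanreal) I"
  define e where "e x = (\<lambda>i\<in>I. f i x)" for x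
  have e_cont: "continuous_map X P e"
    using cont by (auto simp: P_def e_def continuous_map_componentwise)
  have "inj_on e (topspace X)"
  proof (rule inj_onI, rule ccontr)
    fix x y assume xy: "x \<in> topspace X" "y \<in> topspace X" "e x = e y" "x \<noteq> y"
    then have "openin X (topspace X - {y})"
      using \<open>t1_space X\<close> by (simp add: t1_space_closedin_singleton openin_diff)
    then obtain i where "i \<in> I" "f i x = 0" "f i y = 1"
      using sep[of "topspace X - {y}" x] xy by blast
    then have "e x i \<noteq> e y i"
      by (simp add: e_def)
    then show False
      using \<open>e x = e y\<close> by simp
  qed
  moreover have "open_map X (subtopology P (e ` topspace X)) e"
    unfolding open_map_def
  proof (intro allI impI)
    fix U assume U: "openin X U"
    show "openin (subtopology P (e ` topspace X)) (e ` U)"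
    proof (subst openin_subopen, intro ballI, elim imageE, hypsubst)
      fix x assume "x \<in> U"
      then obtain i where i: "i \<in> I" "f i x = 0" and i1: "\<forall>y \<in> topspace X - U. f i y = 1"
        using sep[OF U] by blast
      define T where "T = {z \<in> topspace P. z i \<in> {..<1}}"
      have T: "openin (subtopology P (e ` topspace X)) (T \<inter> e ` topspace X)"
        unfolding T_def
        by (intro openin_subtopology_Int openin_continuous_map_preimage[where Y = euclideanreal])
          (use i continuous_map_product_projection[of i I "\<lambda>_. euclideanreal"] in
            \<open>simp_all add: P_def\<close>)
      have "e x \<in> topspace P"
        using \<open>x \<in> U\<close> openin_subset[OF U] continuous_map_image_subset_topspace[OF e_cont] by blast
      then have "e x \<in> T"
        using i by (simp add: T_def e_def)
      moreover have "T \<inter> e ` topspace X \<subseteq> e ` U"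
      proof clarify
        fix y assume "e y \<in> T" "y \<in> topspace X"
        then have "f i y \<noteq> 1"
          using i(1) by (simp add: T_def e_def)
        with i1 \<open>y \<in> topspace X\<close> show "e y \<in> e ` U"
          by blast
      qed
      ultimately show "\<exists>T. openin (subtopology P (e ` topspace X)) T \<and> e x \<in> T \<and> T \<subseteq> e ` U"
        using T \<open>x \<in> U\<close> openin_subset[OF U] by blast
    qed
  qed
  moreover have "continuous_map X (subtopology P (e ` topspace X)) e"
    using e_cont by (simp add: continuous_map_in_subtopology)
  moreover have "e ` topspace X = topspace (subtopology P (e ` topspace X))"
    using continuous_map_image_subset_topspace[OF e_cont] by auto
  ultimately have "homeomorphic_map X (subtopology P (e ` topspace X)) e"
    by (intro bijective_open_imp_homeomorphic_map)
  moreover have "metrizable_space P"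
    using countable_subset[OF Collect_restrict \<open>countable I\<close>]
    by (simp add: P_def metrizable_space_product_topology metrizable_space_euclidean)
  ultimately show ?thesis
    using homeomorphic_map_imp_homeomorphic_space homeomorphic_metrizable_space
      metrizable_space_subtopology by blast
qed

text \<open>
  A space with a countable base \<open>\<B>\<close> that is regular is normal, being Lindelof. The countable family
  consists of one Urysohn function for each pair \<open>V, W \<in> \<B>\<close> with the closure of \<open>V\<close> contained in \<open>W\<close>.
\<close>

theorem second_countable_regular_imp_metrizable:
  assumes "second_countable X" "regular_space X" "t1_space X"
  shows "metrizable_space X"
proof -
  obtain \<B> where "countable \<B>" and open_\<B>: "\<And>V. V \<in> \<B> \<Longrightarrow> openin X V"
    and base: "\<And>U x. openin X U \<Longrightarrow> x \<in> U \<Longrightarrow> \<exists>V\<in>\<B>. x \<in> V \<and> V \<subseteq> U"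
    using \<open>second_countable X\<close> unfolding second_countable_def by metis
  have "normal_space X"
    using assms regular_Lindelof_imp_normal_space second_countable_imp_Lindelof_space by blast
  define I where "I = {(V, W). V \<in> \<B> \<and> W \<in> \<B> \<and> X closure_of V \<subseteq> W}"
  have "countable I"
    using \<open>countable \<B>\<close> by (intro countable_subset[of I "\<B> \<times> \<B>"]) (auto simp: I_def)
  have "\<exists>g. continuous_map X euclideanreal g \<and> g ` (X closure_of fst i) \<subseteq> {0} \<and>
          g ` (topspace X - snd i) \<subseteq> {1}" if "i \<in> I" for i
  proof -
    have "closedin X (topspace X - snd i)" "disjnt (X closure_of fst i) (topspace X - snd i)"
      using that open_\<B> by (auto simp: I_def disjnt_iff)
    then show ?thesis
      using \<open>normal_space X\<close> unfolding normal_space_iff_Urysohn_alt by simp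
  qed
  then obtain f where f: "\<And>i. i \<in> I \<Longrightarrow> continuous_map X euclideanreal (f i)"
      "\<And>i. i \<in> I \<Longrightarrow> f i ` (X closure_of fst i) \<subseteq> {0}"
      "\<And>i. i \<in> I \<Longrightarrow> f i ` (topspace X - snd i) \<subseteq> {1}"
    by metis
  show ?thesis
  proof (rule separating_family_imp_metrizable[OF \<open>t1_space X\<close> \<open>countable I\<close> f(1)])
    fix U x assume "openin X U" "x \<in> U"
    then obtain W where W: "W \<in> \<B>" "x \<in> W" "W \<subseteq> U"
      using base by blast
    then have "closedin X (topspace X - W)" "x \<in> topspace X - (topspace X - W)"
      using open_\<B> openin_subset by fastforce+
    then obtain G where G: "openin X G" "x \<in> G" "disjnt (topspace X - W) (X closure_of G)"
      using \<open>regular_space X\<close> unfolding regular_space by blast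
    then obtain V where V: "V \<in> \<B>" "x \<in> V" "V \<subseteq> G"
      using base by blast
    have "X closure_of V \<subseteq> W"
      using closure_of_mono[OF \<open>V \<subseteq> G\<close>, of X] G(3) closure_of_subset_topspace[of X V]
      by (auto simp: disjnt_iff)
    then have i: "(V, W) \<in> I"
      using V W by (simp add: I_def)
    moreover have "x \<in> X closure_of V"
      using V open_\<B> closure_of_subset openin_subset by (metis subsetD)
    ultimately show "\<exists>i\<in>I. f i x = 0 \<and> (\<forall>y\<in>topspace X - U. f i y = 1)"
      using f(2,3)[OF i] \<open>W \<subseteq> U\<close> by (intro bexI[of _ "(V, W)"]) auto
  qed
qed


section \<open>The Vietoris topology\<close>

lemma openin_vietoris_subset: "openin X U \<Longrightarrow> openin (vietoris X) {F \<in> Cld X. F \<subseteq> U}"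
  unfolding vietoris_def by (rule topology_generated_by_Basis) blast

text \<open>
  The sets of all non-empty closed \<open>G\<close> that lie in an open set \<open>U\<close> and meet finitely many given open sets form a base
  of the Vietoris topology; here the neighbourhoods of a point \<open>F\<close> are described in this way.
\<close>

lemma vietoris_neighbourhood:
  assumes "openin (vietoris X) \<W>" "F \<in> \<W>"
  obtains U \<V> where "openin X U" "F \<subseteq> U" "finite \<V>"
    "\<And>V. V \<in> \<V> \<Longrightarrow> openin X V \<and> F \<inter> V \<noteq> {}"
    "\<And>G. G \<in> Cld X \<Longrightarrow> G \<subseteq> U \<Longrightarrow> (\<And>V. V \<in> \<V> \<Longrightarrow> G \<inter> V \<noteq> {}) \<Longrightarrow> G \<in> \<W>"
proof -
  define basic where "basic \<W> F \<longleftrightarrow> (\<exists>U \<V>. openin X U \<and> F \<subseteq> U \<and> finite \<V> \<and>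
      (\<forall>V\<in>\<V>. openin X V \<and> F \<inter> V \<noteq> {}) \<and>
      (\<forall>G\<in>Cld X. G \<subseteq> U \<and> (\<forall>V\<in>\<V>. G \<inter> V \<noteq> {}) \<longrightarrow> G \<in> \<W>))" for \<W> F
  have "generate_topology_on
      ({{F \<in> Cld X. F \<inter> U \<noteq> {}} | U. openin X U} \<union> {{F \<in> Cld X. F \<subseteq> U} | U. openin X U}) \<W>"
    using assms(1) unfolding vietoris_def openin_topology_generated_by_iff .
  then have "\<forall>F\<in>\<W>. basic \<W> F"
  proof induction
    case Empty
    then show ?case by simp
  next
    case (Int \<W>1 \<W>2)
    show ?case
    proof
      fix F assume "F \<in> \<W>1 \<inter> \<W>2"
      with Int.IH have "basic \<W>1 F" "basic \<W>2 F"
        by simp_all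
      then show "basic (\<W>1 \<inter> \<W>2) F"
        unfolding basic_def
      proof (elim exE conjE)
        fix U1 \<V>1 U2 \<V>2
        assume 1: "openin X U1" "F \<subseteq> U1" "finite \<V>1" "\<forall>V\<in>\<V>1. openin X V \<and> F \<inter> V \<noteq> {}"
            "\<forall>G\<in>Cld X. G \<subseteq> U1 \<and> (\<forall>V\<in>\<V>1. G \<inter> V \<noteq> {}) \<longrightarrow> G \<in> \<W>1"
          and 2: "openin X U2" "F \<subseteq> U2" "finite \<V>2" "\<forall>V\<in>\<V>2. openin X V \<and> F \<inter> V \<noteq> {}"
            "\<forall>G\<in>Cld X. G \<subseteq> U2 \<and> (\<forall>V\<in>\<V>2. G \<inter> V \<noteq> {}) \<longrightarrow> G \<in> \<W>2"
        show "\<exists>U \<V>. openin X U \<and> F \<subseteq> U \<and> finite \<V> \<and> (\<forall>V\<in>\<V>. openin X V \<and> F \<inter> V \<noteq> {}) \<and>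
            (\<forall>G\<in>Cld X. G \<subseteq> U \<and> (\<forall>V\<in>\<V>. G \<inter> V \<noteq> {}) \<longrightarrow> G \<in> \<W>1 \<inter> \<W>2)"
          by (rule exI[of _ "U1 \<inter> U2"], rule exI[of _ "\<V>1 \<union> \<V>2"]) (use 1 2 in \<open>auto simp: openin_Int ball_Un\<close>)
      qed
    qed
  next
    case (UN K)
    show ?case
    proof
      fix F assume "F \<in> \<Union>K"
      then obtain \<W>' where "\<W>' \<in> K" "basic \<W>' F"
        using UN.IH by blast
      then show "basic (\<Union>K) F"
        unfolding basic_def by (elim ex_forward conj_forward) auto
    qed
  next
    case (Basis \<S>)
    then consider U where "openin X U" "\<S> = {F \<in> Cld X. F \<inter> U \<noteq> {}}"
      | U where "openin X U" "\<S> = {F \<in> Cld X. F \<subseteq> U}"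
      by blast
    then show ?case
    proof cases
      case 1
      then show ?thesis
        unfolding basic_def by (intro ballI exI[of _ "topspace X"] exI[of _ "{U}"])
          (auto simp: Cld_def dest: closedin_subset)
    next
      case 2
      then show ?thesis
        unfolding basic_def by (intro ballI exI[of _ U] exI[of _ "{}"]) auto
    qed
  qed
  then have "basic \<W> F"
    using assms(2) by blast
  then show thesis
    unfolding basic_def by (elim exE conjE) (rule that, auto)
qed

text \<open>
  The non-empty finite subsets of \<open>D\<close> are Vietoris dense among the closed sets that lie in the
  closure of \<open>D\<close>.
\<close>

lemma vietoris_finite_approx:
  assumes "t1_space X" "D \<subseteq> topspace X" "openin (vietoris X) \<W>" "F \<in> \<W>" "F \<subseteq> X closure_of D"
  obtains S where "finite S" "S \<noteq> {}" "S \<subseteq> D" "S \<in> \<W>"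
proof -
  obtain U \<V> where U: "openin X U" "F \<subseteq> U" and "finite \<V>"
    and \<V>: "\<And>V. V \<in> \<V> \<Longrightarrow> openin X V \<and> F \<inter> V \<noteq> {}"
    and \<W>: "\<And>G. G \<in> Cld X \<Longrightarrow> G \<subseteq> U \<Longrightarrow> (\<And>V. V \<in> \<V> \<Longrightarrow> G \<inter> V \<noteq> {}) \<Longrightarrow> G \<in> \<W>"
    using vietoris_neighbourhood[OF assms(3,4)] by metis
  have "F \<in> Cld X"
    using assms(3,4) openin_subset by fastforce
  then have "F \<noteq> {}"
    by (simp add: Cld_def)
  \<comment> \<open>Including \<open>U\<close> itself among the sets to be met makes the finite set non-empty even if \<open>\<V>\<close> is empty.\<close>
  have "\<exists>d. d \<in> D \<inter> U \<inter> V" if "V \<in> insert U \<V>" for V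
  proof -
    have "F \<inter> V \<noteq> {}"
      using \<V>[of V] U(2) \<open>F \<noteq> {}\<close> that by blast
    then obtain x where "x \<in> F" "x \<in> U \<inter> V"
      using U(2) by blast
    moreover have "openin X (U \<inter> V)"
      using \<V> U(1) that by blast
    ultimately obtain d where "d \<in> D" "d \<in> U \<inter> V"
      using assms(5) by (metis in_closure_of subsetD)
    then show ?thesis
      by blast
  qed
  then obtain d where d: "\<And>V. V \<in> insert U \<V> \<Longrightarrow> d V \<in> D \<inter> U \<inter> V"
    by metis
  define S where "S = d ` insert U \<V>"
  have S: "finite S" "S \<noteq> {}" "S \<subseteq> D" "S \<subseteq> U" "\<And>V. V \<in> \<V> \<Longrightarrow> S \<inter> V \<noteq> {}"
    using \<open>finite \<V>\<close> d unfolding S_def by blast+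
  then have "S \<in> Cld X"
    using assms(1,2) by (auto simp: Cld_def t1_space_closedin_finite)
  with S \<W> that show thesis
    by blast
qed

lemma continuous_map_singleton_vietoris:
  assumes "t1_space X"
  shows "continuous_map X (vietoris X) (\<lambda>x. {x})"
  unfolding vietoris_def
proof (rule continuous_on_generated_topo)
  fix \<S> assume "\<S> \<in> {{F \<in> Cld X. F \<inter> U \<noteq> {}} | U. openin X U} \<union> {{F \<in> Cld X. F \<subseteq> U} | U. openin X U}"
  then obtain U where "openin X U" "\<S> = {F \<in> Cld X. F \<inter> U \<noteq> {}} \<or> \<S> = {F \<in> Cld X. F \<subseteq> U}"
    by blast
  moreover have "{x} \<in> Cld X" if "x \<in> topspace X" for x
    using assms that by (simp add: Cld_def t1_space_closedin_singleton)
  ultimately have "(\<lambda>x. {x}) -` \<S> \<inter> topspace X = U"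
    using openin_subset by fastforce
  then show "openin X ((\<lambda>x. {x}) -` \<S> \<inter> topspace X)"
    using \<open>openin X U\<close> by simp
next
  have "{x} \<in> Cld X" if "x \<in> topspace X" for x
    using assms that by (simp add: Cld_def t1_space_closedin_singleton)
  then show "(\<lambda>x. {x}) ` topspace X \<subseteq>
      \<Union> ({{F \<in> Cld X. F \<inter> U \<noteq> {}} | U. openin X U} \<union> {{F \<in> Cld X. F \<subseteq> U} | U. openin X U})"
    using topspace_vietoris[of X] unfolding vietoris_def topology_generated_by_topspace by blast
qed


section \<open>Spaces with a continuous separation of points from closed sets\<close>

text \<open>
  A \<open>T\<^sub>1\<close> space \<open>X\<close> with a fixed map \<open>(\<phi>1, \<phi>2)\<close> witnessing that it is \<open>CT\<^sub>3\<close>. The maps are total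
  functions on pairs of sets; they are constrained only on the pairs in \<open>T3_pairs X\<close>, called
  admissible below.
\<close>

locale CT3_selection =
  fixes X :: "'a topology" and \<phi>1 \<phi>2 :: "'a set \<times> 'a set \<Rightarrow> 'a set"
  assumes t1: "t1_space X"
    and cont: "continuous_map (subtopology (prod_topology (vietoris X) (vietoris X)) (T3_pairs X))
      (prod_topology (vietoris X) (vietoris X)) (\<lambda>p. (\<phi>1 p, \<phi>2 p))"
    and cover: "p \<in> T3_pairs X \<Longrightarrow> \<phi>1 p \<union> \<phi>2 p = topspace X"
    and avoid1: "p \<in> T3_pairs X \<Longrightarrow> fst p \<inter> \<phi>1 p = {}"
    and avoid2: "p \<in> T3_pairs X \<Longrightarrow> snd p \<inter> \<phi>2 p = {}"
begin

lemma T3_pairs_subset: "T3_pairs X \<subseteq> Cld X \<times> Cld X"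
  by (auto simp: T3_pairs_def)

lemma singleton_T3_pair:
  "({x}, F) \<in> T3_pairs X \<longleftrightarrow> x \<in> topspace X \<and> closedin X F \<and> F \<noteq> {} \<and> x \<notin> F"
  using t1 by (auto simp: T3_pairs_def Cld_def t1_space_closedin_singleton dest: closedin_subset)

lemma selection_closed:
  assumes "p \<in> T3_pairs X"
  shows "\<phi>1 p \<in> Cld X" "\<phi>2 p \<in> Cld X"
  using continuous_map_image_subset_topspace[OF cont] assms T3_pairs_subset
  by (auto simp: image_subset_iff)

lemma selection_open:
  assumes "p \<in> T3_pairs X"
  shows "openin X (topspace X - \<phi>1 p)" "openin X (topspace X - \<phi>2 p)"
  using selection_closed[OF assms] by (auto simp: Cld_def)

lemma regular: "regular_space X"
  unfolding regular_space_def
proof clarify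
  fix C a assume C: "closedin X C" and a: "a \<in> topspace X" "a \<notin> C"
  show "\<exists>U V. openin X U \<and> openin X V \<and> a \<in> U \<and> C \<subseteq> V \<and> disjnt U V"
  proof (cases "C = {}")
    case True
    with a show ?thesis
      by (intro exI[of _ "topspace X"] exI[of _ "{}"]) auto
  next
    case False
    with C a have p: "({a}, C) \<in> T3_pairs X"
      by (simp add: singleton_T3_pair)
    show ?thesis
      using selection_open[OF p] cover[OF p] avoid1[OF p] avoid2[OF p] a closedin_subset[OF C]
      by (intro exI[of _ "topspace X - \<phi>1 ({a}, C)"] exI[of _ "topspace X - \<phi>2 ({a}, C)"])
        (auto simp: disjnt_iff)
  qed
qed

text \<open>
  The sets \<open>X - \<phi>1 ({d}, S)\<close> with \<open>d \<in> D\<close> and \<open>S \<subseteq> D\<close> finite are enough to separate the points of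
  the closure of \<open>D\<close> from the closed subsets of this closure. The product of open sets \<open>\<N>\<close> below
  expresses the conditions \<open>x \<notin> \<phi>1\<close> and \<open>F \<inter> \<phi>2 = {}\<close>, which persist when \<open>({x}, F)\<close> is replaced by
  a nearby \<open>({d}, S)\<close>.
\<close>

lemma finite_separation:
  assumes "D \<subseteq> topspace X" "closedin X F" "F \<noteq> {}" "F \<subseteq> X closure_of D"
    and "x \<in> X closure_of D" "x \<notin> F"
  obtains d S where "d \<in> D" "S \<subseteq> D" "finite S" "S \<noteq> {}" "d \<notin> S"
    "x \<notin> \<phi>1 ({d}, S)" "F \<inter> \<phi>2 ({d}, S) = {}"
proof -
  define p where "p = ({x}, F)"
  have x: "x \<in> topspace X"
    using assms by (simp add: in_closure_of)
  then have p: "p \<in> T3_pairs X"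
    using assms by (simp add: p_def singleton_T3_pair)
  define \<N> where "\<N> = {G \<in> Cld X. G \<subseteq> topspace X - {x}} \<times> {G \<in> Cld X. G \<subseteq> topspace X - F}"
  have "openin (prod_topology (vietoris X) (vietoris X)) \<N>"
    unfolding \<N>_def openin_prod_Times_iff
    using assms(2) t1 x by (auto intro!: openin_vietoris_subset simp: t1_space_closedin_singleton openin_diff)
  then have "openin (subtopology (prod_topology (vietoris X) (vietoris X)) (T3_pairs X))
      {q \<in> T3_pairs X. (\<phi>1 q, \<phi>2 q) \<in> \<N>}"
    using openin_continuous_map_preimage[OF cont, of \<N>] T3_pairs_subset
    by (simp add: inf.absorb2)
  then obtain T where T: "openin (prod_topology (vietoris X) (vietoris X)) T"
    and T_eq: "{q \<in> T3_pairs X. (\<phi>1 q, \<phi>2 q) \<in> \<N>} = T \<inter> T3_pairs X"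
    unfolding openin_subtopology by blast
  have "(\<phi>1 p, \<phi>2 p) \<in> \<N>"
    using selection_closed[OF p] avoid1[OF p] avoid2[OF p]
    by (auto simp: \<N>_def p_def Cld_def dest: closedin_subset)
  with p T_eq have "({x}, F) \<in> T"
    unfolding p_def by blast
  then obtain \<A> \<B> where \<A>: "openin (vietoris X) \<A>" "{x} \<in> \<A>"
    and \<B>: "openin (vietoris X) \<B>" "F \<in> \<B>" and sub: "\<A> \<times> \<B> \<subseteq> T"
    using T unfolding openin_prod_topology_alt by meson
  \<comment> \<open>The complements of \<open>\<phi>1 p\<close> and \<open>\<phi>2 p\<close> are disjoint neighbourhoods of \<open>x\<close> and \<open>F\<close>; choosing
    \<open>d\<close> and \<open>S\<close> inside them ensures that \<open>({d}, S)\<close> is again an admissible pair.\<close>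
  define \<B>' where "\<B>' = \<B> \<inter> {G \<in> Cld X. G \<subseteq> topspace X - \<phi>2 p}"
  have "openin (vietoris X) \<B>'"
    unfolding \<B>'_def using \<B>(1) selection_open[OF p] openin_vietoris_subset by blast
  moreover have "F \<in> \<B>'"
    using \<B>(2) assms avoid2[OF p] closedin_subset[of X F] by (auto simp: \<B>'_def Cld_def p_def)
  ultimately obtain S where S: "finite S" "S \<noteq> {}" "S \<subseteq> D" "S \<in> \<B>'"
    using vietoris_finite_approx[OF t1 \<open>D \<subseteq> topspace X\<close>] \<open>F \<subseteq> X closure_of D\<close> by metis
  define W where "W = {y \<in> topspace X. {y} \<in> \<A>} \<inter> (topspace X - \<phi>1 p)"
  have "openin X W"
    unfolding W_def
    using openin_continuous_map_preimage[OF continuous_map_singleton_vietoris[OF t1] \<A>(1)]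
      selection_open[OF p] by blast
  moreover have "x \<in> W"
    using x \<A>(2) avoid1[OF p] by (auto simp: W_def p_def)
  ultimately obtain d where d: "d \<in> D" "d \<in> W"
    using \<open>x \<in> X closure_of D\<close> by (metis in_closure_of)
  have "d \<notin> S"
    using d(2) S(4) cover[OF p] by (auto simp: W_def \<B>'_def)
  moreover have "closedin X S"
    using S(4) by (simp add: \<B>'_def Cld_def)
  ultimately have "({d}, S) \<in> T3_pairs X"
    using S d \<open>D \<subseteq> topspace X\<close> by (auto simp: singleton_T3_pair)
  moreover have "({d}, S) \<in> T"
    using sub d S by (auto simp: W_def \<B>'_def)
  ultimately have "(\<phi>1 ({d}, S), \<phi>2 ({d}, S)) \<in> \<N>"
    using T_eq by blast
  then have "x \<notin> \<phi>1 ({d}, S)" "F \<inter> \<phi>2 ({d}, S) = {}"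
    by (auto simp: \<N>_def)
  with that d S \<open>d \<notin> S\<close> show thesis
    by blast
qed

lemma dense_imp_base:
  assumes Y: "Y \<subseteq> topspace X" and dense: "dense_in (subtopology X Y) D"
  shows "\<exists>\<B>. base_of (subtopology X Y) \<B> \<and> |\<B>| \<le>o |D|"
proof (cases "finite D")
  case True
  then show ?thesis
    using finite_dense_imp_base t1_space_subtopology t1 dense by blast
next
  case False
  have D: "D \<subseteq> Y" "Y \<subseteq> X closure_of D"
    using dense_in_subtopology_closure[OF dense Y] by auto
  define I where "I = {(d, S). d \<in> D \<and> S \<in> Fpow D \<and> S \<noteq> {} \<and> d \<notin> S}"
  define \<B> where "\<B> = insert Y ((\<lambda>(d, S). Y - \<phi>1 ({d}, S)) ` I)"
  have pair: "({d}, S) \<in> T3_pairs X" if "(d, S) \<in> I" for d S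
    using that D(1) Y t1 by (auto simp: I_def singleton_T3_pair Fpow_def t1_space_closedin_finite)
  have "base_of (subtopology X Y) \<B>"
    unfolding base_of_iff
  proof (intro conjI ballI allI impI; (elim conjE)?)
    fix V assume "V \<in> \<B>"
    then consider "V = Y" | d S where "(d, S) \<in> I" "V = (topspace X - \<phi>1 ({d}, S)) \<inter> Y"
      using Y by (auto simp: \<B>_def)
    then show "openin (subtopology X Y) V"
    proof cases
      case 1
      then show ?thesis
        using Y openin_topspace[of "subtopology X Y"] by (simp add: inf.absorb2)
    next
      case 2
      then show ?thesis
        using selection_open(1)[OF pair] unfolding openin_subtopology by blast
    qed
  next
    fix U x assume "openin (subtopology X Y) U" "x \<in> U"
    then obtain G where G: "openin X G" "U = G \<inter> Y"
      unfolding openin_subtopology by blast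
    show "\<exists>V\<in>\<B>. x \<in> V \<and> V \<subseteq> U"
    proof (cases "Y \<subseteq> G")
      case True
      then show ?thesis
        using G \<open>x \<in> U\<close> by (auto simp: \<B>_def)
    next
      case False
      \<comment> \<open>The set \<open>Y - G\<close> itself need not be closed in \<open>X\<close>, but its closure still misses \<open>x\<close>.\<close>
      define F where "F = X closure_of (Y - G)"
      have YG: "Y - G \<subseteq> F"
        unfolding F_def using Y by (intro closure_of_subset) blast
      have "F \<subseteq> X closure_of D"
        unfolding F_def using D(2) by (intro closure_of_minimal) auto
      moreover have "x \<notin> F"
        using G \<open>x \<in> U\<close> by (auto simp: F_def in_closure_of)
      moreover have "closedin X F" "F \<noteq> {}"
        using False YG by (auto simp: F_def)
      moreover have "x \<in> X closure_of D"
        using \<open>x \<in> U\<close> G D(2) by blast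
      ultimately obtain d S where dS: "d \<in> D" "S \<subseteq> D" "finite S" "S \<noteq> {}" "d \<notin> S"
          "x \<notin> \<phi>1 ({d}, S)" "F \<inter> \<phi>2 ({d}, S) = {}"
        using finite_separation[of D F x] D(1) Y by blast
      then have I: "(d, S) \<in> I"
        by (simp add: I_def Fpow_def)
      have "Y - \<phi>1 ({d}, S) \<subseteq> U"
        using cover[OF pair[OF I]] dS(7) YG Y G by blast
      moreover have "x \<in> Y - \<phi>1 ({d}, S)"
        using dS(6) \<open>x \<in> U\<close> G by blast
      moreover have "Y - \<phi>1 ({d}, S) \<in> \<B>"
        using I by (auto simp: \<B>_def)
      ultimately show ?thesis
        by blast
    qed
  qed
  moreover have "|\<B>| \<le>o |D|"
  proof -
    have "|I| \<le>o |D \<times> Fpow D|"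
      by (rule card_of_mono1) (auto simp: I_def)
    also have "|D \<times> Fpow D| \<le>o |D|"
      using False by (intro card_of_Times_ordLeq_infinite_Field)
        (simp_all add: card_of_Fpow_ordLeq Field_card_of card_of_mono1 card_of_card_order_on)
    finally have "|(\<lambda>(d, S). Y - \<phi>1 ({d}, S)) ` I| \<le>o |D|"
      using card_of_image ordLeq_transitive by blast
    moreover have "|{Y}| \<le>o |D|"
      using False by (simp add: ordLeq3_finite_infinite)
    ultimately show ?thesis
      unfolding \<B>_def using False
      by (subst insert_is_Un, intro card_of_Un_ordLeq_infinite_Field)
        (simp_all add: Field_card_of card_of_card_order_on)
  qed
  ultimately show ?thesis
    by blast
qed

lemma weight_eq_density:
  assumes "Y \<subseteq> topspace X"
  shows "top_weight (subtopology X Y) =o top_density (subtopology X Y)"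
proof -
  obtain \<B> where \<B>: "base_of (subtopology X Y) \<B>" "top_weight (subtopology X Y) = |\<B>|"
      "\<And>\<B>'. base_of (subtopology X Y) \<B>' \<Longrightarrow> |\<B>| \<le>o |\<B>'|"
    unfolding top_weight_def using least_card_attained[of "base_of _", OF base_of_openin] by metis
  obtain D where D: "dense_in (subtopology X Y) D" "top_density (subtopology X Y) = |D|"
      "\<And>D'. dense_in (subtopology X Y) D' \<Longrightarrow> |D| \<le>o |D'|"
    unfolding top_density_def using least_card_attained[of "dense_in _", OF dense_in_topspace] by metis
  have "|\<B>| \<le>o |D|"
    using dense_imp_base[OF assms D(1)] \<B>(3) ordLeq_transitive by blast
  moreover have "|D| \<le>o |\<B>|"
    using base_imp_dense[OF \<B>(1)] D(3) ordLeq_transitive by blast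
  ultimately show ?thesis
    unfolding \<B>(2) D(2) by (simp add: ordIso_iff_ordLeq)
qed

lemma separable_imp_metrizable:
  assumes "Y \<subseteq> topspace X" "separable_space (subtopology X Y)"
  shows "metrizable_space (subtopology X Y)"
proof -
  obtain D where "countable D" "dense_in (subtopology X Y) D"
    using assms(2) unfolding separable_space_def dense_in_def by blast
  then obtain \<B> where \<B>: "base_of (subtopology X Y) \<B>" "|\<B>| \<le>o |D|"
    using dense_imp_base[OF assms(1)] by blast
  have "countable \<B>"
    using \<B>(2) \<open>countable D\<close> by (metis card_of_ordLeq countable_lepoll lepoll_def)
  then have "second_countable (subtopology X Y)"
    using \<B>(1) unfolding second_countable base_of_def by blast
  then show ?thesis
    using second_countable_regular_imp_metrizable regular_space_subtopology[OF regular]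
      t1_space_subtopology[OF t1] by blast
qed

end


section \<open>Weight, density and metrizability of subspaces\<close>

theorem theorem5p1:
  fixes X :: "'a topology"
  assumes "t1_space X" and "topspace X \<noteq> {}" and "CT3_space X"
  shows "(\<forall>Y. Y \<subseteq> topspace X \<and> Y \<noteq> {} \<longrightarrow>
            top_weight (subtopology X Y) =o top_density (subtopology X Y)) \<and>
         (\<forall>Y. Y \<subseteq> topspace X \<and> Y \<noteq> {} \<and> separable_space (subtopology X Y) \<longrightarrow>
            metrizable_space (subtopology X Y))"
proof -
  obtain \<phi>1 \<phi>2 where \<phi>: "continuous_map
         (subtopology (prod_topology (vietoris X) (vietoris X)) (T3_pairs X))
         (prod_topology (vietoris X) (vietoris X)) (\<lambda>p. (\<phi>1 p, \<phi>2 p))"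
      "\<forall>(F1, F2) \<in> T3_pairs X. \<phi>1 (F1, F2) \<union> \<phi>2 (F1, F2) = topspace X \<and>
         F1 \<inter> \<phi>1 (F1, F2) = {} \<and> F2 \<inter> \<phi>2 (F1, F2) = {}"
    using \<open>CT3_space X\<close> unfolding CT3_space_def by blast
  interpret CT3_selection X \<phi>1 \<phi>2
    by unfold_locales (use \<open>t1_space X\<close> \<phi> in \<open>auto 0 3\<close>)
  show ?thesis
    using weight_eq_density separable_imp_metrizable by blast
qed

end
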